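(* Fix $\vartheta>0$ and let $L_n^{(\vartheta)}$ be the number of leaves in a Hoppe tree with parameter $\vartheta$ and $n\geq 2$ nodes. Then, as $n\to\infty$, \begin{align*} \mathbb{E}[L_n^{(\vartheta)}] &= \frac{n}{2}+ \frac{\vartheta-1}{2} + \mathcal{O}\left( \frac{1}{n} \right),\\ \mathrm{Var}( L_n^{(\vartheta)} ) &= \frac{n}{12}+ \frac{\vartheta-1}{12} + \mathcal{O}\left( \frac{1}{n} \right),\\ \frac{L_n^{(\vartheta)}-\mathbb{E}[L_n^{(\vartheta)}]}{\sqrt{\mathrm{Var}(L_n^{(\vartheta)})}} &\stackrel{d}{\longrightarrow} \mathcal{N}(0,1), \end{align*} and moreover $$\mathbb{P}(|L_n^{(\vartheta)}- \mathbb{E}[L_n^{(\vartheta)}]| \geq t ) \leq 2 \exp\left( - \frac{6 t^2}{n+\vartheta+1} \right) \quad\text{for all } t>0,\ n\ge 1.$$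
   Context: Hoppe tree with parameter $\vartheta>0$: the tree is grown by successive insertion of nodes. Initially there is only the root. In each step a parent node is chosen among the existing nodes, independently of the past, with probability proportional to its weight, where the root has weight $\vartheta$ and every other node has weight $1$; a new node is attached as a child of the chosen node. The Hoppe tree with $n$ nodes is the tree after $n-1$ insertions. A leaf is a node with no children. $\mathcal{N}(0,1)$ is the standard normal distribution. *)

theory Defs
  imports "HOL-Probability.Probability" "HOL-Library.Landau_Symbols"
begin

text \<open>Nodes of the Hoppe tree are labelled 0,1,2,... in order of insertion; node 0 is the root.
  A tree with n nodes is encoded by the list of parents ps of length n-1, where ps!i is the
  parent of node i+1.\<close>

text \<open>Choice of the parent when k nodes 0..k-1 already exist: the root (weight theta)
  with probability theta/(theta+k-1), otherwise uniformly one of the k-1 non-root nodes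
  (each of weight 1).\<close>
definition hoppe_parent :: "real \<Rightarrow> nat \<Rightarrow> nat pmf" where
  "hoppe_parent \<theta> k =
     bind_pmf (bernoulli_pmf (\<theta> / (\<theta> + real (k - 1))))
       (\<lambda>b. if b then return_pmf 0 else pmf_of_set {1..<k})"

fun hoppe_parents :: "real \<Rightarrow> nat \<Rightarrow> nat list pmf" where
  "hoppe_parents \<theta> 0 = return_pmf []"
| "hoppe_parents \<theta> (Suc m) =
     bind_pmf (hoppe_parents \<theta> m) (\<lambda>ps.
       map_pmf (\<lambda>p. ps @ [p]) (hoppe_parent \<theta> (Suc m)))"

definition hoppe_tree :: "real \<Rightarrow> nat \<Rightarrow> nat list pmf" where
  "hoppe_tree \<theta> n = hoppe_parents \<theta> (n - 1)"

definition num_leaves :: "nat \<Rightarrow> nat list \<Rightarrow> nat" where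
  "num_leaves n ps = card ({0..<n} - set ps)"

definition hoppe_leaves :: "real \<Rightarrow> nat \<Rightarrow> nat pmf" where
  "hoppe_leaves \<theta> n = map_pmf (num_leaves n) (hoppe_tree \<theta> n)"

definition leaves_mean :: "real \<Rightarrow> nat \<Rightarrow> real" where
  "leaves_mean \<theta> n = measure_pmf.expectation (hoppe_leaves \<theta> n) real"

definition leaves_var :: "real \<Rightarrow> nat \<Rightarrow> real" where
  "leaves_var \<theta> n = measure_pmf.variance (hoppe_leaves \<theta> n) real"

end

theory Submission
  imports Defs "HOL-Real_Asymp.Real_Asymp"
begin

text \<open>
  Once the root has a child, a new node turns the leaf it is attached to into an inner node and
  is itself a leaf. Hence, for \<open>n \<ge> 2\<close> and \<open>s = \<theta> + n - 1\<close>, \<open>L (n+1) = L n + 1 - B\<close> where, given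
  \<open>L n\<close>, \<open>B\<close> is a Bernoulli variable with parameter \<open>p = L n / s\<close>, and the centred variables satisfy
  \<open>X (n+1) = (1 - 1/s) * X n + (p - B)\<close>. The first two moments follow from linear recurrences.
  As \<open>p - B\<close> takes values in an interval of length one, Hoeffding's lemma shows by induction that
  \<open>X n\<close> is sub-Gaussian with variance proxy \<open>(n + \<theta> + 1) / 12\<close>, whence the tail bound.
  The conditional variance \<open>p * (1 - p)\<close> is within \<open>O(1/n)\<close> of \<open>1/4\<close> on average, so the
  characteristic function of \<open>X n\<close> nearly satisfies the recurrence of the Gaussian
  \<open>exp (- u^2 * Var (L n) / 2)\<close>; at \<open>u = t / sqrt (Var (L n))\<close> the accumulated error vanishes,
  and Levy's continuity theorem gives the limit law.
\<close>

section \<open>The insertion step and the Markov chain of leaf counts\<close>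

text \<open>As \<open>A\<close> does not contain the root, it can only be hit in the non-root
  branch, taken with probability \<open>(k - 1) / (\<theta> + k - 1)\<close>; there the hit has
  probability \<open>card A / (k - 1)\<close>.\<close>

lemma map_hoppe_parent_mem:
  assumes "\<theta> > 0" "k \<ge> 2" "A \<subseteq> {1..<k}"
  shows "map_pmf (\<lambda>p. p \<in> A) (hoppe_parent \<theta> k) = bernoulli_pmf (real (card A) / (\<theta> + real k - 1))"
proof -
  have cA: "card A \<le> k - 1"
    using assms card_mono[of "{1..<k}" A] by auto
  let ?M = "map_pmf (\<lambda>p. p \<in> A) (hoppe_parent \<theta> k)"
  have q: "0 \<le> \<theta> / (\<theta> + real (k - 1))" "\<theta> / (\<theta> + real (k - 1)) \<le> 1"
    using assms by (auto simp: field_simps)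
  have r: "real (card A) / (\<theta> + real k - 1) \<le> 1" "real (card A) / (\<theta> + real k - 1) \<ge> 0"
    using assms cA by (auto simp: field_simps of_nat_diff)
  have "?M = bind_pmf (bernoulli_pmf (\<theta> / (\<theta> + real (k - 1))))
       (\<lambda>b. if b then return_pmf False else map_pmf (\<lambda>p. p \<in> A) (pmf_of_set {1..<k}))"
    unfolding hoppe_parent_def map_bind_pmf
    using assms by (intro bind_pmf_cong) auto
  then have "pmf ?M True = (1 - \<theta> / (\<theta> + real (k - 1))) * pmf (map_pmf (\<lambda>p. p \<in> A) (pmf_of_set {1..<k})) True"
    using q by (simp add: pmf_bind)
  also have "pmf (map_pmf (\<lambda>p. p \<in> A) (pmf_of_set {1..<k})) True = card A / (k - 1)"
    using assms by (simp add: pmf_map vimage_def measure_pmf_of_set Int_absorb1)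
  also have "(1 - \<theta> / (\<theta> + real (k - 1))) * (card A / (k - 1)) = card A / (\<theta> + real k - 1)"
  proof -
    have "1 - \<theta> / (\<theta> + real (k - 1)) = real (k - 1) / (\<theta> + real k - 1)"
      using assms by (simp add: field_simps)
    then show ?thesis using assms by simp
  qed
  finally have T: "pmf ?M True = pmf (bernoulli_pmf (real (card A) / (\<theta> + real k - 1))) True"
    using r by simp
  show ?thesis
  proof (rule pmf_eqI)
    fix b :: bool
    show "pmf ?M b = pmf (bernoulli_pmf (real (card A) / (\<theta> + real k - 1))) b"
      using T by (cases b) (auto simp only: pmf_False_conv_True)
  qed
qed

text \<open>The Bernoulli parameter is \<open>\<theta> / \<theta> = 1\<close>, so the branch that
  would draw from the empty set \<open>{1..<1}\<close> is never taken.\<close>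

lemma hoppe_parent_1:
  assumes "\<theta> > 0"
  shows "hoppe_parent \<theta> 1 = return_pmf 0"
proof -
  have "bernoulli_pmf 1 = return_pmf True"
  proof (rule pmf_eqI)
    show "pmf (bernoulli_pmf 1) b = pmf (return_pmf True) b" for b
      by (cases b) simp_all
  qed
  then show ?thesis using assms by (simp add: hoppe_parent_def bind_return_pmf)
qed

lemma set_hoppe_parent:
  assumes "\<theta> > 0" "k \<ge> 1"
  shows "set_pmf (hoppe_parent \<theta> k) \<subseteq> {..<k}"
proof (cases "k = 1")
  case True
  then show ?thesis using hoppe_parent_1[OF assms(1)] by simp
next
  case False
  then show ?thesis using assms by (auto simp: hoppe_parent_def split: if_splits)
qed

text \<open>The first insertion can only choose the root. From two nodes on the root is therefore an
  inner node, and every leaf has weight one.\<close>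

lemma set_hoppe_parents:
  assumes "\<theta> > 0" "ps \<in> set_pmf (hoppe_parents \<theta> m)"
  shows "set ps \<subseteq> {..<m}" "m \<ge> 1 \<Longrightarrow> 0 \<in> set ps"
proof -
  have "set ps \<subseteq> {..<m} \<and> (m \<ge> 1 \<longrightarrow> 0 \<in> set ps)" using assms(2)
  proof (induction m arbitrary: ps)
    case (Suc m)
    obtain qs p where *: "qs \<in> set_pmf (hoppe_parents \<theta> m)" "p \<in> set_pmf (hoppe_parent \<theta> (Suc m))" "ps = qs @ [p]"
      using Suc.prems by auto
    have "p < Suc m" using *(2) set_hoppe_parent[OF assms(1), of "Suc m"] by auto
    then show ?case using Suc.IH[OF *(1)] *(3) by (cases m) auto
  qed simp
  then show "set ps \<subseteq> {..<m}" "m \<ge> 1 \<Longrightarrow> 0 \<in> set ps" by auto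
qed

lemma hoppe_leaves_1: "hoppe_leaves \<theta> (Suc 0) = return_pmf 1"
  by (simp add: hoppe_leaves_def hoppe_tree_def num_leaves_def)

lemma hoppe_leaves_2:
  assumes "\<theta> > 0"
  shows "hoppe_leaves \<theta> 2 = return_pmf 1"
proof -
  have "card ({0..<2} - {0 :: nat}) = 1" by (simp add: numeral_2_eq_2 atLeast0_lessThan_Suc)
  then show ?thesis using hoppe_parent_1[OF assms]
    by (simp add: hoppe_leaves_def hoppe_tree_def num_leaves_def numeral_2_eq_2 bind_return_pmf)
qed

lemma hoppe_leaves_Suc:
  assumes "\<theta> > 0" "n \<ge> 2"
  shows "hoppe_leaves \<theta> (Suc n) = bind_pmf (hoppe_leaves \<theta> n)
    (\<lambda>l. map_pmf (\<lambda>b. if b then l else Suc l) (bernoulli_pmf (real l / (\<theta> + real n - 1))))"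
proof -
  obtain m where m: "n = Suc m" "m \<ge> 1" using assms(2) by (cases n) auto
  have "hoppe_leaves \<theta> (Suc n) = bind_pmf (hoppe_parents \<theta> m)
     (\<lambda>ps. map_pmf (\<lambda>p. num_leaves (Suc n) (ps @ [p])) (hoppe_parent \<theta> n))"
    by (simp add: hoppe_leaves_def hoppe_tree_def m map_bind_pmf map_pmf_comp)
  also have "\<dots> = bind_pmf (hoppe_parents \<theta> m)
     (\<lambda>ps. map_pmf (\<lambda>b. if b then num_leaves n ps else Suc (num_leaves n ps))
        (bernoulli_pmf (num_leaves n ps / (\<theta> + real n - 1))))"
  proof (intro bind_pmf_cong refl)
    fix ps assume ps: "ps \<in> set_pmf (hoppe_parents \<theta> m)"
    \<comment> \<open>\<open>A\<close> is the set of leaves; it avoids the root, as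
      \<open>map_hoppe_parent_mem\<close> demands.\<close>
    define A where "A = {0..<n} - set ps"
    have ss: "set ps \<subseteq> {..<m}" "0 \<in> set ps" using set_hoppe_parents[OF assms(1) ps] m by auto
    have A: "A \<subseteq> {1..<n}" using ss by (auto simp: A_def Suc_le_eq intro: Nat.gr0I)
    have "num_leaves (Suc n) (ps @ [p]) = (if p \<in> A then num_leaves n ps else Suc (num_leaves n ps))"
      if "p < n" for p
    proof -
      have fin: "finite A" by (simp add: A_def)
      \<comment> \<open>The new node \<open>n\<close> becomes a leaf and its parent \<open>p\<close>
        stops being one, so the count grows exactly when \<open>p\<close> was not a leaf.\<close>
      have "{0..<Suc n} - set (ps @ [p]) = insert n (A - {p})"
        using ss that m by (auto simp: A_def)
      moreover have "card (insert n (A - {p})) = Suc (card (A - {p}))"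
        using fin by (subst card_insert_disjoint) (auto simp: A_def)
      ultimately show ?thesis
        using fin by (auto simp: num_leaves_def A_def[symmetric] card_Suc_Diff1 simp del: card_Diff_insert)
    qed
    then have "map_pmf (\<lambda>p. num_leaves (Suc n) (ps @ [p])) (hoppe_parent \<theta> n) =
       map_pmf (\<lambda>b. if b then num_leaves n ps else Suc (num_leaves n ps)) (map_pmf (\<lambda>p. p \<in> A) (hoppe_parent \<theta> n))"
      unfolding map_pmf_comp using set_hoppe_parent[OF assms(1), of n] m
      by (intro map_pmf_cong) auto
    also have "map_pmf (\<lambda>p. p \<in> A) (hoppe_parent \<theta> n) = bernoulli_pmf (num_leaves n ps / (\<theta> + real n - 1))"
      using map_hoppe_parent_mem[OF assms A] by (simp add: num_leaves_def A_def)
    finally show "map_pmf (\<lambda>p. num_leaves (Suc n) (ps @ [p])) (hoppe_parent \<theta> n) =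
       map_pmf (\<lambda>b. if b then num_leaves n ps else Suc (num_leaves n ps)) (bernoulli_pmf (num_leaves n ps / (\<theta> + real n - 1)))" .
  qed
  finally show ?thesis
    unfolding hoppe_leaves_def[of _ n] hoppe_tree_def bind_map_pmf by (simp add: m)
qed

text \<open>The strict bound gives \<open>l \<le> n - 1 < \<theta> + n - 1\<close>, which makes the
  Bernoulli parameter of the chain a genuine probability. The weak bound also covers the single-node
  tree.\<close>

lemma set_hoppe_leaves:
  assumes "\<theta> > 0" "n \<ge> 1"
  shows "set_pmf (hoppe_leaves \<theta> n) \<subseteq> {..n}" "n \<ge> 2 \<Longrightarrow> set_pmf (hoppe_leaves \<theta> n) \<subseteq> {..<n}"
proof -
  show *: "set_pmf (hoppe_leaves \<theta> n) \<subseteq> {..<n}" if "n \<ge> 2"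
    using that
  proof (induction n rule: dec_induct)
    case base
    then show ?case by (simp add: hoppe_leaves_2[OF assms(1)])
  next
    case (step n)
    then show ?case by (auto simp: hoppe_leaves_Suc[OF assms(1)] split: if_splits)
  qed
  show "set_pmf (hoppe_leaves \<theta> n) \<subseteq> {..n}"
  proof (cases "n = 1")
    case False
    then show ?thesis using * assms by force
  qed (simp add: hoppe_leaves_1)
qed

lemma finite_set_hoppe_leaves: "\<theta> > 0 \<Longrightarrow> n \<ge> 1 \<Longrightarrow> finite (set_pmf (hoppe_leaves \<theta> n))"
  using set_hoppe_leaves(1) finite_subset by blast

text \<open>The codomain is kept general so that real moments and complex characteristic functions
  share one recurrence. Finite support turns the integrals into finite sums.\<close>

lemma expectation_step:
  fixes f :: "nat \<Rightarrow> 'b::{banach, second_countable_topology}"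
  assumes "\<theta> > 0" "n \<ge> 2"
  defines "s \<equiv> \<theta> + real n - 1"
  shows "measure_pmf.expectation (hoppe_leaves \<theta> (Suc n)) f =
    measure_pmf.expectation (hoppe_leaves \<theta> n) (\<lambda>l. (1 - real l / s) *\<^sub>R f (Suc l) + (real l / s) *\<^sub>R f l)"
proof -
  let ?A = "set_pmf (hoppe_leaves \<theta> n)"
  have fin: "finite ?A" using assms finite_set_hoppe_leaves by simp
  have s: "0 \<le> real l / s \<and> real l / s \<le> 1" if "l \<in> ?A" for l
    using set_hoppe_leaves(2)[of \<theta> n] assms that by (auto simp: field_simps subset_iff less_eq_Suc_le)
  have "measure_pmf.expectation (hoppe_leaves \<theta> (Suc n)) f =
    (\<Sum>l\<in>?A. pmf (hoppe_leaves \<theta> n) l *\<^sub>R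
       measure_pmf.expectation (map_pmf (\<lambda>b. if b then l else Suc l) (bernoulli_pmf (real l / s))) f)"
    unfolding hoppe_leaves_Suc[OF assms(1,2)] s_def
    using fin by (intro pmf_expectation_bind) auto
  also have "\<dots> = (\<Sum>l\<in>?A. pmf (hoppe_leaves \<theta> n) l *\<^sub>R ((1 - real l / s) *\<^sub>R f (Suc l) + (real l / s) *\<^sub>R f l))"
  proof (intro sum.cong refl)
    fix l assume "l \<in> ?A"
    then show "pmf (hoppe_leaves \<theta> n) l *\<^sub>R
       measure_pmf.expectation (map_pmf (\<lambda>b. if b then l else Suc l) (bernoulli_pmf (real l / s))) f =
       pmf (hoppe_leaves \<theta> n) l *\<^sub>R ((1 - real l / s) *\<^sub>R f (Suc l) + (real l / s) *\<^sub>R f l)"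
      unfolding integral_map_pmf using s
      by (subst integral_measure_pmf[of UNIV]) (auto simp: UNIV_bool)
  qed
  also have "\<dots> = measure_pmf.expectation (hoppe_leaves \<theta> n) (\<lambda>l. (1 - real l / s) *\<^sub>R f (Suc l) + (real l / s) *\<^sub>R f l)"
    using fin by (subst integral_measure_pmf[of ?A]) auto
  finally show ?thesis .
qed

text \<open>The probability that the next node is attached to a leaf, valid for \<open>n \<ge> 2\<close> only: then the root
  is not a leaf, so each of the \<open>l\<close> leaves has weight one.\<close>

definition leaf_prob :: "real \<Rightarrow> nat \<Rightarrow> nat \<Rightarrow> real" where
  "leaf_prob \<theta> n l = real l / (\<theta> + real n - 1)"

text \<open>\<open>E(X (n+1) | X n) = shrink \<theta> n * X n\<close> for the centred variables \<open>X n\<close>.\<close>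

definition shrink :: "real \<Rightarrow> nat \<Rightarrow> real" where
  "shrink \<theta> n = 1 - 1 / (\<theta> + real n - 1)"

text \<open>The mean conditional variance of one step, which is what a step adds to the variance by
  the law of total variance.\<close>

definition mean_leaf_var :: "real \<Rightarrow> nat \<Rightarrow> real" where
  "mean_leaf_var \<theta> n = measure_pmf.expectation (hoppe_leaves \<theta> n) (\<lambda>l. leaf_prob \<theta> n l * (1 - leaf_prob \<theta> n l))"

section \<open>Estimates for a single centred Bernoulli variable\<close>

text \<open>Hoeffding's lemma for \<open>p - B\<close>. The logarithmic inequality behind it needs a
  nonnegative argument; for negative \<open>h\<close> the other exponential is factored out, which
  replaces \<open>h\<close> by \<open>- h\<close> and \<open>1 - p\<close> by
  \<open>p\<close>.\<close>

lemma bernoulli_centred_mgf_le: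
  fixes p h :: real
  assumes "0 \<le> p" "p \<le> 1"
  shows "(1 - p) * exp (h * p) + p * exp (h * (p - 1)) \<le> exp (h\<^sup>2 / 8)"
proof -
  have aux: "exp (- h * q) * (1 + q * (exp h - 1)) \<le> exp (h\<^sup>2 / 8)" if "0 \<le> q" "q \<le> 1" "h \<ge> 0" for q h :: real
  proof -
    have pos: "1 + q * (exp h - 1) > 0"
      using that by (intro add_pos_nonneg mult_nonneg_nonneg) auto
    have "exp (- h * q) * (1 + q * (exp h - 1)) = exp (- h * q + ln (1 + q * (exp h - 1)))"
      unfolding exp_add exp_ln[OF pos] ..
    also have "\<dots> \<le> exp (h\<^sup>2 / 8)"
      using Hoeffdings_lemma_aux[of h q] that by simp
    finally show ?thesis .
  qed
  show ?thesis
  proof (cases "h \<ge> 0")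
    case True
    have "exp (h * p) = exp (- h * (1 - p)) * exp h" "exp (h * (p - 1)) = exp (- h * (1 - p))"
      by (simp_all flip: exp_add add: algebra_simps)
    then have "(1 - p) * exp (h * p) + p * exp (h * (p - 1)) = exp (- h * (1 - p)) * (1 + (1 - p) * (exp h - 1))"
      by (simp add: algebra_simps)
    then show ?thesis using aux[of "1 - p" h] assms True by simp
  next
    case False
    have "exp (h * (p - 1)) = exp (h * p) * exp (- h)"
      by (simp flip: exp_add add: algebra_simps)
    then have "(1 - p) * exp (h * p) + p * exp (h * (p - 1)) = exp (- (- h) * p) * (1 + p * (exp (- h) - 1))"
      by (simp add: algebra_simps)
    then show ?thesis using aux[of p "- h"] assms False by simp
  qed
qed

text \<open>The upper bound inverts the quadratic lower bound for \<open>exp a\<close>, using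
  \<open>(1 - a + a^2/2) * (1 + a + a^2/2) = 1 + a^4/4\<close>.\<close>

lemma exp_minus_approx:
  fixes a :: real
  assumes "a \<ge> 0"
  shows "\<bar>exp (- a) - (1 - a)\<bar> \<le> a\<^sup>2 / 2"
proof -
  have "exp (- a) \<le> inverse (1 + a + a\<^sup>2 / 2)"
    unfolding exp_minus using assms exp_lower_Taylor_quadratic[OF assms]
    by (intro le_imp_inverse_le) (auto intro: add_pos_nonneg)
  also have "\<dots> \<le> 1 - a + a\<^sup>2 / 2"
  proof -
    have "(1 - a + a\<^sup>2 / 2) * (1 + a + a\<^sup>2 / 2) = 1 + (a\<^sup>2)\<^sup>2 / 4"
      by (simp add: power2_eq_square algebra_simps)
    then have "1 \<le> (1 - a + a\<^sup>2 / 2) * (1 + a + a\<^sup>2 / 2)" by simp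
    moreover have "1 + a + a\<^sup>2 / 2 > 0" using assms by (intro add_pos_nonneg) auto
    ultimately show ?thesis by (simp add: inverse_eq_divide pos_divide_le_eq)
  qed
  finally show ?thesis using exp_ge_add_one_self[of "- a"] by simp
qed

lemma iexp_approx_quadratic: "cmod (iexp x - (1 + \<i> * x - x\<^sup>2 / 2)) \<le> \<bar>x\<bar> ^ 3 / 6"
  using iexp_approx1[of x 2] by (simp add: eval_nat_numeral fact_numeral algebra_simps)

text \<open>Both sides are compared with their expansions to second order in \<open>u\<close>. The
  variance mismatch is split into \<open>(p - 1/2)^2\<close> and \<open>1/4 - v\<close> because both
  can be controlled after averaging over \<open>p\<close>.\<close>

lemma bernoulli_centred_char_approx:
  fixes p u v :: real
  assumes p: "0 \<le> p" "p \<le> 1" and v: "0 \<le> v" "v \<le> 1/4"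
  shows "cmod ((1 - p) *\<^sub>R iexp (u * p) + p *\<^sub>R iexp (u * (p - 1)) - exp (- (u\<^sup>2 * v / 2)))
    \<le> \<bar>u\<bar> ^ 3 + u ^ 4 + u\<^sup>2 / 2 * ((p - 1/2)\<^sup>2 + (1/4 - v))"
proof -
  define r where "r x = iexp x - (1 + \<i> * x - x\<^sup>2 / 2)" for x :: real
  define q where "q = p * (1 - p)"
  have iexp_r: "iexp x = r x + (1 + \<i> * x - x\<^sup>2 / 2)" for x by (simp add: r_def)
  have r: "cmod (r (u * y)) \<le> \<bar>u\<bar> ^ 3" if "\<bar>y\<bar> \<le> 1" for y
  proof -
    have "cmod (r (u * y)) \<le> \<bar>u * y\<bar> ^ 3 / 6"
      unfolding r_def by (rule iexp_approx_quadratic)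
    also have "\<dots> \<le> \<bar>u * y\<bar> ^ 3" by simp
    also have "\<dots> \<le> \<bar>u\<bar> ^ 3"
      using that by (intro power_mono) (auto simp: abs_mult mult_left_le)
    finally show ?thesis .
  qed
  \<comment> \<open>The linear terms cancel since \<open>p - B\<close> has mean zero, and the
    quadratic ones combine to the Bernoulli variance \<open>q\<close>.\<close>
  have "(1 - p) *\<^sub>R iexp (u * p) + p *\<^sub>R iexp (u * (p - 1)) - exp (- (u\<^sup>2 * v / 2)) =
     ((1 - p) *\<^sub>R r (u * p) + p *\<^sub>R r (u * (p - 1))) + of_real (u\<^sup>2 / 2 * (v - q))
       - of_real (exp (- (u\<^sup>2 * v / 2)) - (1 - u\<^sup>2 * v / 2))"
    unfolding iexp_r scaleR_conv_of_real q_def by (simp add: field_simps power2_eq_square)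
  also have "cmod \<dots> \<le> cmod ((1 - p) *\<^sub>R r (u * p) + p *\<^sub>R r (u * (p - 1))) + cmod (of_real (u\<^sup>2 / 2 * (v - q)))
       + cmod (of_real (exp (- (u\<^sup>2 * v / 2)) - (1 - u\<^sup>2 * v / 2)))"
    by (intro order_trans[OF norm_triangle_ineq4] add_mono norm_triangle_ineq order_refl)
  also have "\<dots> \<le> \<bar>u\<bar> ^ 3 + u\<^sup>2 / 2 * ((p - 1/2)\<^sup>2 + (1/4 - v)) + u ^ 4"
  proof (intro add_mono)
    have "cmod ((1 - p) *\<^sub>R r (u * p) + p *\<^sub>R r (u * (p - 1))) \<le> (1 - p) * cmod (r (u * p)) + p * cmod (r (u * (p - 1)))"
      using p by (intro order_trans[OF norm_triangle_ineq]) simp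
    also have "\<dots> \<le> (1 - p) * \<bar>u\<bar> ^ 3 + p * \<bar>u\<bar> ^ 3"
      using p by (intro add_mono mult_left_mono r) auto
    finally show "cmod ((1 - p) *\<^sub>R r (u * p) + p *\<^sub>R r (u * (p - 1))) \<le> \<bar>u\<bar> ^ 3"
      by (simp add: algebra_simps)
    have "v - q = (p - 1/2)\<^sup>2 - (1/4 - v)" by (simp add: q_def power2_eq_square algebra_simps)
    then have "\<bar>v - q\<bar> \<le> (p - 1/2)\<^sup>2 + (1/4 - v)" using v by (simp add: abs_le_iff) (smt (verit) zero_le_power2)
    then show "cmod (of_real (u\<^sup>2 / 2 * (v - q))) \<le> u\<^sup>2 / 2 * ((p - 1/2)\<^sup>2 + (1/4 - v))"
      unfolding norm_of_real abs_mult by (intro mult_mono) auto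
    have "\<bar>exp (- (u\<^sup>2 * v / 2)) - (1 - u\<^sup>2 * v / 2)\<bar> \<le> (u\<^sup>2 * v / 2)\<^sup>2 / 2"
      using v by (intro exp_minus_approx) auto
    also have "\<dots> \<le> (u\<^sup>2 * v / 2)\<^sup>2" by simp
    also have "\<dots> \<le> (u\<^sup>2)\<^sup>2"
    proof (intro power_mono)
      have "u\<^sup>2 * v \<le> u\<^sup>2 * 2" using v by (intro mult_left_mono) auto
      then show "u\<^sup>2 * v / 2 \<le> u\<^sup>2" by simp
    qed (use v in auto)
    finally show "cmod (of_real (exp (- (u\<^sup>2 * v / 2)) - (1 - u\<^sup>2 * v / 2))) \<le> u ^ 4"
      unfolding norm_of_real by simp
  qed
  finally show ?thesis by simp
qed

section \<open>Exact recurrences for mean and variance\<close>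

context
  fixes \<theta> :: real
  assumes \<theta>: "\<theta> > 0"
begin

lemma integrable_hoppe_leaves [simp]:
  fixes f :: "nat \<Rightarrow> 'b::{banach, second_countable_topology}"
  shows "n \<ge> 1 \<Longrightarrow> integrable (measure_pmf (hoppe_leaves \<theta> n)) f"
  using \<theta> by (intro integrable_measure_pmf_finite finite_set_hoppe_leaves)

lemma leaf_prob_bounds:
  assumes "n \<ge> 2" "l \<in> set_pmf (hoppe_leaves \<theta> n)"
  shows "0 \<le> leaf_prob \<theta> n l" "leaf_prob \<theta> n l \<le> 1"
  using set_hoppe_leaves(2)[of \<theta> n] assms \<theta>
  by (auto simp: leaf_prob_def field_simps subset_iff less_eq_Suc_le)

lemma leaves_mean_Suc:
  assumes "n \<ge> 2"
  shows "leaves_mean \<theta> (Suc n) = shrink \<theta> n * leaves_mean \<theta> n + 1"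
proof -
  have "leaves_mean \<theta> (Suc n) = measure_pmf.expectation (hoppe_leaves \<theta> n) (\<lambda>l. shrink \<theta> n * real l + 1)"
    unfolding leaves_mean_def expectation_step[OF \<theta> assms]
    by (intro arg_cong[where f = "integral\<^sup>L _"] ext) (simp add: shrink_def algebra_simps add_divide_distrib)
  then show ?thesis using assms by (simp add: leaves_mean_def)
qed

text \<open>With \<open>s = \<theta> + n - 1\<close>, \<open>s / 2\<close> is a particular solution
  of the recurrence, and multiples of \<open>1 / (s - 1)\<close> solve the homogeneous one, as
  \<open>shrink\<close> equals \<open>(s - 1) / s\<close>. The factor
  \<open>(1 - \<theta>) * \<theta> / 2\<close> is fixed by mean 1 at \<open>n = 2\<close>.\<close>

lemma leaves_mean_eq:
  assumes "n \<ge> 2"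
  shows "leaves_mean \<theta> n = (\<theta> + real n - 1) / 2 + (1 - \<theta>) * \<theta> / (2 * (\<theta> + real n - 2))"
  using assms
proof (induction n rule: dec_induct)
  case base
  then show ?case using \<theta> by (simp add: leaves_mean_def hoppe_leaves_2[OF \<theta>] field_simps)
next
  case (step n)
  define s where "s = \<theta> + real n - 1"
  have "s > 1" using step(1) \<theta> by (simp add: s_def)
  have "leaves_mean \<theta> (Suc n) = (1 - 1 / s) * (s / 2 + (1 - \<theta>) * \<theta> / (2 * (s - 1))) + 1"
    using step leaves_mean_Suc[of n] by (simp add: shrink_def s_def algebra_simps)
  also have "\<dots> = (s + 1) / 2 + (1 - \<theta>) * \<theta> / (2 * s)"
    using \<open>s > 1\<close> by (simp add: divide_simps) (simp add: algebra_simps)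
  finally show ?case by (simp add: s_def algebra_simps)
qed

lemma centred_step:
  assumes "n \<ge> 2"
  shows "real (Suc l) - leaves_mean \<theta> (Suc n) = shrink \<theta> n * (real l - leaves_mean \<theta> n) + leaf_prob \<theta> n l"
    and "real l - leaves_mean \<theta> (Suc n) = shrink \<theta> n * (real l - leaves_mean \<theta> n) + (leaf_prob \<theta> n l - 1)"
  by (simp_all add: leaves_mean_Suc[OF assms] shrink_def leaf_prob_def algebra_simps diff_divide_distrib)

lemma centred_expectation_step:
  fixes f :: "real \<Rightarrow> 'b::{banach, second_countable_topology}"
  assumes "n \<ge> 2"
  shows "measure_pmf.expectation (hoppe_leaves \<theta> (Suc n)) (\<lambda>l. f (real l - leaves_mean \<theta> (Suc n))) =
    measure_pmf.expectation (hoppe_leaves \<theta> n) (\<lambda>l.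
      (1 - leaf_prob \<theta> n l) *\<^sub>R f (shrink \<theta> n * (real l - leaves_mean \<theta> n) + leaf_prob \<theta> n l) +
      leaf_prob \<theta> n l *\<^sub>R f (shrink \<theta> n * (real l - leaves_mean \<theta> n) + (leaf_prob \<theta> n l - 1)))"
  unfolding expectation_step[OF \<theta> assms] leaf_prob_def[symmetric] centred_step(1)[OF assms]
  unfolding centred_step(2)[OF assms] ..

lemma expectation_centred:
  assumes "n \<ge> 1"
  shows "measure_pmf.expectation (hoppe_leaves \<theta> n) (\<lambda>l. real l - leaves_mean \<theta> n) = 0"
  using assms by (simp add: leaves_mean_def)

lemma leaves_var_alt:
  "leaves_var \<theta> n = measure_pmf.expectation (hoppe_leaves \<theta> n) (\<lambda>l. (real l - leaves_mean \<theta> n)\<^sup>2)"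
  by (simp add: leaves_var_def leaves_mean_def)

lemma leaves_var_Suc:
  assumes "n \<ge> 2"
  shows "leaves_var \<theta> (Suc n) = (shrink \<theta> n)\<^sup>2 * leaves_var \<theta> n + mean_leaf_var \<theta> n"
proof -
  \<comment> \<open>There is no cross term because \<open>p - B\<close> has conditional mean
    zero.\<close>
  have *: "(1 - p) * (a + p)\<^sup>2 + p * (a + (p - 1))\<^sup>2 = a\<^sup>2 + p * (1 - p)" for a p :: real
    by (simp add: power2_eq_square algebra_simps)
  have "leaves_var \<theta> (Suc n) = measure_pmf.expectation (hoppe_leaves \<theta> n)
      (\<lambda>l. (shrink \<theta> n)\<^sup>2 * (real l - leaves_mean \<theta> n)\<^sup>2 + leaf_prob \<theta> n l * (1 - leaf_prob \<theta> n l))"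
    unfolding leaves_var_alt centred_expectation_step[OF assms, of "\<lambda>x. x\<^sup>2"]
    by (simp add: * power_mult_distrib)
  then show ?thesis using assms by (simp add: leaves_var_alt mean_leaf_var_def)
qed

text \<open>\<open>leaf_prob\<close> minus \<open>1/2\<close> is the centred leaf count divided by
  \<open>s\<close> plus a deterministic offset \<open>c\<close> from the exact mean; squaring leaves
  a cross term of mean zero.\<close>

lemma expectation_leaf_prob_dev:
  assumes "n \<ge> 2"
  shows "measure_pmf.expectation (hoppe_leaves \<theta> n) (\<lambda>l. (leaf_prob \<theta> n l - 1/2)\<^sup>2) =
    leaves_var \<theta> n / (\<theta> + real n - 1)\<^sup>2 +
    ((1 - \<theta>) * \<theta> / (2 * (\<theta> + real n - 1) * (\<theta> + real n - 2)))\<^sup>2"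
proof -
  define s where "s = \<theta> + real n - 1"
  define r where "r = \<theta> + real n - 2"
  define c where "c = (1 - \<theta>) * \<theta> / (2 * s * r)"
  have "s > 1" using assms \<theta> by (simp add: s_def)
  have "r > 0" using assms \<theta> by (simp add: r_def)
  have m: "leaves_mean \<theta> n = s / 2 + s * c"
    using \<open>s > 1\<close> \<open>r > 0\<close> leaves_mean_eq[OF assms]
    by (simp only: r_def[symmetric] s_def[symmetric]) (simp add: c_def)
  have eq: "(leaf_prob \<theta> n l - 1/2)\<^sup>2 =
      (real l - leaves_mean \<theta> n)\<^sup>2 / s\<^sup>2 + (2 * c / s) * (real l - leaves_mean \<theta> n) + c\<^sup>2" for l
  proof -
    have "leaf_prob \<theta> n l - 1/2 = (real l - leaves_mean \<theta> n) / s + c"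
      using \<open>s > 1\<close> by (simp add: leaf_prob_def s_def[symmetric] m field_simps)
    then show ?thesis by (simp add: power2_eq_square algebra_simps)
  qed
  have "measure_pmf.expectation (hoppe_leaves \<theta> n) (\<lambda>l. (leaf_prob \<theta> n l - 1/2)\<^sup>2) =
      leaves_var \<theta> n / s\<^sup>2 + (2 * c / s) *
        measure_pmf.expectation (hoppe_leaves \<theta> n) (\<lambda>l. real l - leaves_mean \<theta> n) + c\<^sup>2"
    unfolding eq leaves_var_alt using assms by simp
  then show ?thesis using expectation_centred[of n] assms by (simp only: c_def s_def r_def)
qed

lemma mean_leaf_var_alt:
  assumes "n \<ge> 2"
  shows "mean_leaf_var \<theta> n =
    1/4 - measure_pmf.expectation (hoppe_leaves \<theta> n) (\<lambda>l. (leaf_prob \<theta> n l - 1/2)\<^sup>2)"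
proof -
  have "p * (1 - p) = 1/4 - (p - 1/2)\<^sup>2" for p :: real
    by (simp add: power2_eq_square algebra_simps)
  then show ?thesis using assms by (simp add: mean_leaf_var_def)
qed

lemma mean_leaf_var_bounds:
  assumes "n \<ge> 2"
  shows "0 \<le> mean_leaf_var \<theta> n" "mean_leaf_var \<theta> n \<le> 1/4"
proof -
  show "0 \<le> mean_leaf_var \<theta> n"
    unfolding mean_leaf_var_def using leaf_prob_bounds[OF assms]
    by (intro integral_nonneg_AE) (auto simp: AE_measure_pmf_iff)
  show "mean_leaf_var \<theta> n \<le> 1/4"
    by (simp add: mean_leaf_var_alt[OF assms])
qed

section \<open>Sub-Gaussian bound and tail estimate\<close>

lemma leaves_mgf_le:
  assumes "n \<ge> 2"
  shows "measure_pmf.expectation (hoppe_leaves \<theta> n) (\<lambda>l. exp (h * (real l - leaves_mean \<theta> n)))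
    \<le> exp (h\<^sup>2 * (real n + \<theta> + 1) / 24)"
  using assms
proof (induction n arbitrary: h rule: dec_induct)
  case base
  have "leaves_mean \<theta> 2 = 1" by (simp add: leaves_mean_def hoppe_leaves_2[OF \<theta>])
  then show ?case using \<theta> by (simp add: hoppe_leaves_2[OF \<theta>])
next
  case (step n)
  define s where "s = \<theta> + real n - 1"
  have "s > 1" using step \<theta> by (simp add: s_def)
  let ?E = "measure_pmf.expectation (hoppe_leaves \<theta> n)"
  let ?X = "\<lambda>l. real l - leaves_mean \<theta> n"
  define a where "a = shrink \<theta> n"
  have "measure_pmf.expectation (hoppe_leaves \<theta> (Suc n)) (\<lambda>l. exp (h * (real l - leaves_mean \<theta> (Suc n)))) =
     ?E (\<lambda>l. exp (h * a * ?X l) *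
       ((1 - leaf_prob \<theta> n l) * exp (h * leaf_prob \<theta> n l) + leaf_prob \<theta> n l * exp (h * (leaf_prob \<theta> n l - 1))))"
    by (subst centred_expectation_step[OF step(1), of "\<lambda>x. exp (h * x)"])
       (simp add: a_def distrib_left exp_add mult_ac)
  also have "\<dots> \<le> ?E (\<lambda>l. exp (h * a * ?X l) * exp (h\<^sup>2 / 8))"
    using step(1) \<theta> leaf_prob_bounds[OF step(1)]
    by (intro integral_mono_AE) (auto simp: AE_measure_pmf_iff intro!: bernoulli_centred_mgf_le)
  also have "\<dots> = ?E (\<lambda>l. exp (h * a * ?X l)) * exp (h\<^sup>2 / 8)"
    using step(1) \<theta> by simp
  also have "\<dots> \<le> exp ((h * a)\<^sup>2 * (real n + \<theta> + 1) / 24) * exp (h\<^sup>2 / 8)"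
    by (intro mult_right_mono step.IH) auto
  also have "\<dots> = exp (h\<^sup>2 / 24 * (a\<^sup>2 * (s + 2) + 3))"
    by (simp flip: exp_add add: s_def power_mult_distrib field_simps)
  \<comment> \<open>In units of \<open>1/12\<close> the proxy is \<open>s + 2\<close>: shrinking
    lowers it to at most \<open>s\<close>, and Hoeffding's \<open>h^2 / 8\<close> adds 3. The
    inequality rests on \<open>(s - 1)^2 * (s + 2) = s^3 - 3 * s + 2\<close>.\<close>
  also have "a\<^sup>2 * (s + 2) + 3 \<le> s + 3"
  proof -
    have "a = (s - 1) / s" using \<open>s > 1\<close> by (simp add: a_def shrink_def s_def[symmetric] field_simps)
    moreover have "(s - 1)\<^sup>2 * (s + 2) \<le> s * s\<^sup>2"
      using \<open>s > 1\<close> by (simp add: power2_eq_square algebra_simps)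
    ultimately show ?thesis using \<open>s > 1\<close> by (simp add: power_divide divide_le_eq)
  qed
  then have "exp (h\<^sup>2 / 24 * (a\<^sup>2 * (s + 2) + 3)) \<le> exp (h\<^sup>2 / 24 * (s + 3))"
    by (simp add: mult_left_mono)
  also have "h\<^sup>2 / 24 * (s + 3) = h\<^sup>2 * (real (Suc n) + \<theta> + 1) / 24"
    by (simp add: s_def)
  finally show ?case .
qed

lemma leaves_one_sided_tail:
  assumes "n \<ge> 2" "t > 0" "\<bar>\<epsilon>\<bar> = 1"
  shows "measure_pmf.prob (hoppe_leaves \<theta> n) {k. \<epsilon> * (real k - leaves_mean \<theta> n) \<ge> t}
    \<le> exp (- (6 * t\<^sup>2) / (real n + \<theta> + 1))"
proof -
  define N where "N = real n + \<theta> + 1"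
  have "N > 0" using \<theta> by (simp add: N_def)
  \<comment> \<open>The minimiser of the Chernoff exponent
    \<open>h^2 * N / 24 - h * t\<close>.\<close>
  define h where "h = 12 * t / N"
  have "h > 0" using assms \<open>N > 0\<close> by (simp add: h_def)
  have e2: "\<epsilon>\<^sup>2 = 1" using assms(3) by (simp add: abs_square_eq_1)
  let ?M = "measure_pmf (hoppe_leaves \<theta> n)"
  let ?X = "\<lambda>k. real k - leaves_mean \<theta> n"
  have "measure ?M {k \<in> space ?M. exp (h * (\<epsilon> * ?X k)) \<ge> exp (h * t)} \<le>
     measure_pmf.expectation (hoppe_leaves \<theta> n) (\<lambda>k. exp (h * (\<epsilon> * ?X k))) / exp (h * t)"
    using assms \<theta> by (intro integral_Markov_inequality_measure[where A = "{}"]) auto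
  also have "{k \<in> space ?M. exp (h * (\<epsilon> * ?X k)) \<ge> exp (h * t)} = {k. \<epsilon> * ?X k \<ge> t}"
    using \<open>h > 0\<close> by simp
  also have "measure_pmf.expectation (hoppe_leaves \<theta> n) (\<lambda>k. exp (h * (\<epsilon> * ?X k))) / exp (h * t) \<le> exp (h\<^sup>2 * N / 24) / exp (h * t)"
    using leaves_mgf_le[OF assms(1), of "h * \<epsilon>"]
    by (intro divide_right_mono) (simp_all add: mult.assoc N_def power_mult_distrib e2)
  also have "\<dots> = exp (h\<^sup>2 * N / 24 - h * t)"
    by (simp add: exp_diff)
  also have "h\<^sup>2 * N / 24 - h * t = - (6 * t\<^sup>2) / N"
    using \<open>N > 0\<close> by (simp add: h_def power2_eq_square field_simps)
  finally show ?thesis by (simp add: N_def)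
qed

lemma leaves_tail:
  assumes "n \<ge> 1" "t > 0"
  shows "measure_pmf.prob (hoppe_leaves \<theta> n) {k. \<bar>real k - leaves_mean \<theta> n\<bar> \<ge> t}
    \<le> 2 * exp (- (6 * t\<^sup>2) / (real n + \<theta> + 1))"
proof (cases "n = 1")
  case True
  \<comment> \<open>The leaf count of a single node is constant, so the deviation event is
    empty.\<close>
  have "leaves_mean \<theta> (Suc 0) = 1" by (simp add: leaves_mean_def hoppe_leaves_1)
  then show ?thesis using True assms by (simp add: hoppe_leaves_1)
next
  case False
  then have n: "n \<ge> 2" using assms by simp
  let ?X = "\<lambda>k. real k - leaves_mean \<theta> n"
  have "{k. \<bar>?X k\<bar> \<ge> t} = {k. 1 * ?X k \<ge> t} \<union> {k. - 1 * ?X k \<ge> t}" by auto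
  then have "measure_pmf.prob (hoppe_leaves \<theta> n) {k. \<bar>?X k\<bar> \<ge> t} \<le>
     measure_pmf.prob (hoppe_leaves \<theta> n) {k. 1 * ?X k \<ge> t} + measure_pmf.prob (hoppe_leaves \<theta> n) {k. - 1 * ?X k \<ge> t}"
    by (simp only: measure_Un_le sets_measure_pmf UNIV_I)
  also have "\<dots> \<le> exp (- (6 * t\<^sup>2) / (real n + \<theta> + 1)) + exp (- (6 * t\<^sup>2) / (real n + \<theta> + 1))"
    using n assms(2) by (intro add_mono leaves_one_sided_tail) auto
  finally show ?thesis by simp
qed

section \<open>Asymptotics of mean and variance\<close>

lemma leaves_mean_asymp:
  "(\<lambda>n. leaves_mean \<theta> n - (real n / 2 + (\<theta> - 1) / 2)) \<in> O(\<lambda>n. 1 / real n)"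
proof -
  have "(\<lambda>n. (1 - \<theta>) * \<theta> / (2 * (\<theta> + real n - 2))) \<in> O(\<lambda>n. 1 / real n)"
    by real_asymp
  moreover have "\<forall>\<^sub>F n in sequentially. leaves_mean \<theta> n - (real n / 2 + (\<theta> - 1) / 2) =
      (1 - \<theta>) * \<theta> / (2 * (\<theta> + real n - 2))"
    using eventually_ge_at_top[of 2] by eventually_elim (simp add: leaves_mean_eq add_divide_distrib diff_divide_distrib)
  ultimately show ?thesis by (subst landau_o.big.in_cong)
qed

text \<open>The term \<open>leaves_var / s^2\<close> from the squared shrink factor cancels against
  the one in \<open>mean_leaf_var\<close>, leaving the factor \<open>1 - 2 / s\<close>. Up to the
  squared offset, \<open>s / 12\<close> solves the resulting recurrence.\<close>

lemma leaves_var_dev_Suc: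
  assumes "n \<ge> 2"
  defines "s \<equiv> \<theta> + real n - 1"
  shows "leaves_var \<theta> (Suc n) - (s + 1) / 12 =
    (1 - 2 / s) * (leaves_var \<theta> n - s / 12) - ((1 - \<theta>) * \<theta> / (2 * s * (s - 1)))\<^sup>2"
proof -
  have "s > 1" using assms \<theta> by simp
  have eq: "\<theta> + real n - 2 = s - 1" by (simp add: s_def)
  have "leaves_var \<theta> (Suc n) = (1 - 1 / s)\<^sup>2 * leaves_var \<theta> n + (1/4 - (leaves_var \<theta> n / s\<^sup>2 +
     ((1 - \<theta>) * \<theta> / (2 * s * (s - 1)))\<^sup>2))"
    unfolding leaves_var_Suc[OF assms(1)] mean_leaf_var_alt[OF assms(1)]
      expectation_leaf_prob_dev[OF assms(1)] shrink_def eq s_def[symmetric] ..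
  also have "(1 - 1 / s)\<^sup>2 * leaves_var \<theta> n = leaves_var \<theta> n - 2 / s * leaves_var \<theta> n + leaves_var \<theta> n / s\<^sup>2"
    by (simp add: power2_eq_square algebra_simps)
  finally have "leaves_var \<theta> (Suc n) = leaves_var \<theta> n - 2 / s * leaves_var \<theta> n + 1/4 -
      ((1 - \<theta>) * \<theta> / (2 * s * (s - 1)))\<^sup>2" by simp
  moreover have "(1 - 2 / s) * (leaves_var \<theta> n - s / 12) = leaves_var \<theta> n - 2 / s * leaves_var \<theta> n - s / 12 + 1 / 6"
    using \<open>s > 1\<close> by (simp add: field_simps)
  ultimately show ?thesis by (simp add: add_divide_distrib)
qed

lemma leaves_var_dev_bound:
  obtains C where "C \<ge> 0" "\<And>n. n \<ge> 3 \<Longrightarrow> \<bar>leaves_var \<theta> n - (\<theta> + real n - 1) / 12\<bar> \<le> C / (\<theta> + real n - 2)"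
proof -
  define K where "K = ((1 - \<theta>) * \<theta>)\<^sup>2"
  \<comment> \<open>The first entry settles the base case, the second dominates the squared offset.
    Starting at \<open>n = 3\<close> gives \<open>s > 2\<close>, so that \<open>1 - 2 / s\<close> is
    positive.\<close>
  define C where "C = max (\<bar>leaves_var \<theta> 3 - (\<theta> + 2) / 12\<bar> * (\<theta> + 1)) K"
  have "0 \<le> K" "K \<le> C" by (simp_all add: C_def K_def)
  then have "C \<ge> 0" by simp
  have "\<bar>leaves_var \<theta> n - (\<theta> + real n - 1) / 12\<bar> \<le> C / (\<theta> + real n - 2)" if "n \<ge> 3" for n
    using that
  proof (induction n rule: dec_induct)
    case base
    have "\<bar>leaves_var \<theta> 3 - (\<theta> + 2) / 12\<bar> * (\<theta> + 1) \<le> C" by (simp add: C_def)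
    then show ?case using \<theta> by (simp add: pos_le_divide_eq add_ac)
  next
    case (step n)
    define s where "s = \<theta> + real n - 1"
    have "s > 2" using step \<theta> by (simp add: s_def)
    have c: "((1 - \<theta>) * \<theta> / (2 * s * (s - 1)))\<^sup>2 \<le> C / (s * (s - 1))"
    proof -
      have "1 * 1 \<le> s * (s - 1)" using \<open>s > 2\<close> by (intro mult_mono) auto
      then have "s * (s - 1) * 1 \<le> s * (s - 1) * (4 * (s * (s - 1)))" by (intro mult_left_mono) auto
      then have "K / (4 * (s * (s - 1))\<^sup>2) \<le> C / (s * (s - 1))"
        using \<open>s > 2\<close> \<open>C \<ge> 0\<close> \<open>K \<le> C\<close> by (intro frac_le) (auto simp: power2_eq_square mult_ac)
      moreover have "((1 - \<theta>) * \<theta> / (2 * s * (s - 1)))\<^sup>2 = K / (4 * (s * (s - 1))\<^sup>2)"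
        by (simp only: K_def power_divide power_mult_distrib mult.assoc) simp
      ultimately show ?thesis by simp
    qed
    have "\<bar>leaves_var \<theta> (Suc n) - (s + 1) / 12\<bar> \<le>
       \<bar>(1 - 2 / s) * (leaves_var \<theta> n - s / 12)\<bar> + \<bar>((1 - \<theta>) * \<theta> / (2 * s * (s - 1)))\<^sup>2\<bar>"
      using leaves_var_dev_Suc[of n] step(1) unfolding s_def by (simp only: abs_triangle_ineq4)
    also have "\<dots> \<le> (1 - 2 / s) * (C / (s - 1)) + C / (s * (s - 1))"
      using step(3) c \<open>s > 2\<close> unfolding abs_mult s_def
      by (intro add_mono mult_mono) (simp_all add: algebra_simps)
    also have "\<dots> = C / s" using \<open>s > 2\<close> by (simp add: divide_simps) (simp add: algebra_simps)
    finally show ?case by (simp add: s_def algebra_simps)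
  qed
  then show ?thesis using that \<open>C \<ge> 0\<close> by blast
qed

lemma leaves_var_asymp:
  "(\<lambda>n. leaves_var \<theta> n - (real n / 12 + (\<theta> - 1) / 12)) \<in> O(\<lambda>n. 1 / real n)"
proof -
  obtain C where C: "C \<ge> 0" "\<And>n. n \<ge> 3 \<Longrightarrow> \<bar>leaves_var \<theta> n - (\<theta> + real n - 1) / 12\<bar> \<le> C / (\<theta> + real n - 2)"
    by (rule leaves_var_dev_bound) blast
  have "(\<lambda>n. leaves_var \<theta> n - (real n / 12 + (\<theta> - 1) / 12)) \<in> O(\<lambda>n. C / (\<theta> + real n - 2))"
  proof (rule bigoI[of _ 1])
    show "\<forall>\<^sub>F n in sequentially. norm (leaves_var \<theta> n - (real n / 12 + (\<theta> - 1) / 12)) \<le> 1 * norm (C / (\<theta> + real n - 2))"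
      using eventually_ge_at_top[of 3]
    proof eventually_elim
      case (elim n)
      have eq: "real n / 12 + (\<theta> - 1) / 12 = (\<theta> + real n - 1) / 12" by simp
      show ?case unfolding eq using C(2)[OF elim] C(1) \<theta> elim by simp
    qed
  qed
  also have "(\<lambda>n. C / (\<theta> + real n - 2)) \<in> O(\<lambda>n. 1 / real n)" by real_asymp
  finally show ?thesis .
qed

section \<open>Central limit theorem\<close>

lemma shrink_bounds:
  assumes "n \<ge> 2"
  shows "0 \<le> shrink \<theta> n" "shrink \<theta> n \<le> 1"
  using assms \<theta> by (auto simp: shrink_def field_simps)

lemma leaves_var_nonneg: "0 \<le> leaves_var \<theta> n"
  by (simp add: leaves_var_alt)

lemma leaves_var_le:
  assumes "n \<ge> 2"
  shows "leaves_var \<theta> n \<le> real n / 4"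
  using assms
proof (induction n rule: dec_induct)
  case base
  then show ?case by (simp add: leaves_var_def hoppe_leaves_2[OF \<theta>])
next
  case (step n)
  have "(shrink \<theta> n)\<^sup>2 * leaves_var \<theta> n \<le> 1 * leaves_var \<theta> n"
    using shrink_bounds[OF step(1)] leaves_var_nonneg by (intro mult_right_mono power_le_one) auto
  then show ?case using step mean_leaf_var_bounds(2)[OF step(1)] leaves_var_Suc[OF step(1)] by simp
qed

text \<open>The gap is the mean squared deviation of \<open>leaf_prob\<close> from
  \<open>1/2\<close>, whose two parts are both of order \<open>1 / s\<close>. The denominator
  \<open>Suc n\<close> is chosen so that summing over \<open>n\<close> telescopes into a
  logarithm.\<close>

lemma mean_leaf_var_lower:
  assumes "n \<ge> 2"
  shows "1/4 - mean_leaf_var \<theta> n \<le> 3 * (1 + (1 - \<theta>)\<^sup>2) / real (Suc n)"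
proof -
  define s where "s = \<theta> + real n - 1"
  have n2: "real n \<ge> 2" using assms by linarith
  have s: "s > 1" "real (Suc n) / 3 \<le> s" "real n / 2 \<le> s" using n2 \<theta> by (auto simp: s_def)
  \<comment> \<open>The split isolates \<open>\<theta> / (s - 1)\<close>, which is at most 1 because
    \<open>s - 1 = \<theta> + n - 2\<close>.\<close>
  have "(1 - \<theta>) * \<theta> / (2 * s * (s - 1)) = (1 - \<theta>) / (2 * s) * (\<theta> / (s - 1))" by simp
  moreover have "0 \<le> \<theta> / (s - 1)" "\<theta> / (s - 1) \<le> 1" using n2 \<theta> by (auto simp: s_def)
  ultimately have "((1 - \<theta>) * \<theta> / (2 * s * (s - 1)))\<^sup>2 \<le> ((1 - \<theta>) / (2 * s))\<^sup>2"
    by (simp only: power_mult_distrib) (intro mult_left_le power_le_one; simp)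
  also have "\<dots> = (1 - \<theta>)\<^sup>2 / (4 * s * s)" by (simp add: power2_eq_square)
  also have "\<dots> \<le> (1 - \<theta>)\<^sup>2 / s"
  proof (intro divide_left_mono)
    have "s * 1 \<le> s * (4 * s)" using s by (intro mult_left_mono) auto
    then show "s \<le> 4 * s * s" by simp
  qed (use s in auto)
  finally have 1: "((1 - \<theta>) * \<theta> / (2 * s * (s - 1)))\<^sup>2 \<le> (1 - \<theta>)\<^sup>2 / s" .
  have "leaves_var \<theta> n / s\<^sup>2 \<le> s / s\<^sup>2"
    using leaves_var_le[OF assms] s n2 by (intro divide_right_mono) auto
  then have 2: "leaves_var \<theta> n / s\<^sup>2 \<le> 1 / s" using s by (simp add: power2_eq_square)
  have eq: "\<theta> + real n - 2 = s - 1" by (simp add: s_def)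
  have "1/4 - mean_leaf_var \<theta> n \<le> 1 / s + (1 - \<theta>)\<^sup>2 / s"
    using 1 2 unfolding mean_leaf_var_alt[OF assms] expectation_leaf_prob_dev[OF assms] eq s_def[symmetric]
    by linarith
  also have "\<dots> = (1 + (1 - \<theta>)\<^sup>2) / s" by (simp add: add_divide_distrib)
  also have "\<dots> \<le> (1 + (1 - \<theta>)\<^sup>2) / (real (Suc n) / 3)"
    using s by (intro divide_left_mono) auto
  finally show ?thesis by (simp add: mult.commute)
qed

text \<open>Each step changes the frequency from \<open>u\<close> to
  \<open>u * shrink \<theta> n\<close>, so the induction runs over all \<open>u\<close>; since
  \<open>shrink\<close> is at most 1, earlier errors do not grow.\<close>

lemma centred_char_approx:
  assumes "n \<ge> 2"
  shows "cmod (measure_pmf.expectation (hoppe_leaves \<theta> n) (\<lambda>l. iexp (u * (real l - leaves_mean \<theta> n)))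
      - exp (- (u\<^sup>2 * leaves_var \<theta> n / 2)))
    \<le> real n * (\<bar>u\<bar> ^ 3 + u ^ 4) + 3 * (1 + (1 - \<theta>)\<^sup>2) * u\<^sup>2 * ln (real n)"
  using assms
proof (induction n arbitrary: u rule: dec_induct)
  case base
  have "leaves_mean \<theta> 2 = 1" "leaves_var \<theta> 2 = 0" by (simp_all add: leaves_mean_def leaves_var_def hoppe_leaves_2[OF \<theta>])
  then show ?case by (simp add: hoppe_leaves_2[OF \<theta>])
next
  case (step n)
  define D where "D = 3 * (1 + (1 - \<theta>)\<^sup>2)"
  have "D \<ge> 0" by (simp add: D_def)
  define a where "a = shrink \<theta> n"
  define v where "v = mean_leaf_var \<theta> n"
  let ?E = "measure_pmf.expectation (hoppe_leaves \<theta> n)"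
  let ?X = "\<lambda>l. real l - leaves_mean \<theta> n"
  let ?p = "leaf_prob \<theta> n"
  define \<psi> where "\<psi> l = (1 - ?p l) *\<^sub>R iexp (u * ?p l) + ?p l *\<^sub>R iexp (u * (?p l - 1))" for l
  define e where "e = exp (- (u\<^sup>2 * v / 2))"
  define g where "g = exp (- ((u * a)\<^sup>2 * leaves_var \<theta> n / 2))"
  define \<phi> where "\<phi> = ?E (\<lambda>l. iexp (u * a * ?X l))"
  have n: "n \<ge> 2" "n \<ge> 1" using step by auto
  have v: "0 \<le> v" "v \<le> 1/4" using mean_leaf_var_bounds[OF n(1)] by (auto simp: v_def)
  have a: "0 \<le> a" "a \<le> 1" using shrink_bounds[OF n(1)] by (auto simp: a_def)
  have "e \<ge> 0" "e \<le> 1" using v by (auto simp: e_def)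
  note [simp] = integrable_hoppe_leaves[OF n(2)]

  have "measure_pmf.expectation (hoppe_leaves \<theta> (Suc n)) (\<lambda>l. iexp (u * (real l - leaves_mean \<theta> (Suc n)))) =
     ?E (\<lambda>l. iexp (u * a * ?X l) * \<psi> l)"
    by (subst centred_expectation_step[OF n(1), of "\<lambda>x. iexp (u * x)"])
       (simp add: a_def \<psi>_def distrib_left exp_add mult_ac scaleR_conv_of_real)
  \<comment> \<open>The conditional characteristic function \<open>\<psi>\<close> of the step is
    replaced by the constant \<open>e\<close>; the first term is the new error, the second the
    inherited one.\<close>
  also have "\<dots> - of_real (g * e) = ?E (\<lambda>l. iexp (u * a * ?X l) * (\<psi> l - e)) + (\<phi> - g) * e"
    by (simp add: \<phi>_def algebra_simps)
  also have "cmod \<dots> \<le> cmod (?E (\<lambda>l. iexp (u * a * ?X l) * (\<psi> l - e))) + cmod ((\<phi> - g) * e)"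
    by (rule norm_triangle_ineq)
  also have "cmod ((\<phi> - g) * e) \<le> cmod (\<phi> - g)"
    using \<open>e \<ge> 0\<close> \<open>e \<le> 1\<close> by (simp add: norm_mult mult_left_le)
  also have "cmod (\<phi> - g) \<le> real n * (\<bar>u * a\<bar> ^ 3 + (u * a) ^ 4) + D * (u * a)\<^sup>2 * ln (real n)"
    using step.IH[of "u * a"] by (simp add: \<phi>_def g_def D_def)
  also have "\<dots> \<le> real n * (\<bar>u\<bar> ^ 3 + u ^ 4) + D * u\<^sup>2 * ln (real n)"
  proof -
    have "\<bar>u * a\<bar> \<le> \<bar>u\<bar>" using a by (simp add: abs_mult mult_left_le)
    then have "\<bar>u * a\<bar> ^ k \<le> \<bar>u\<bar> ^ k" for k by (intro power_mono) auto
    from this[of 2] this[of 3] this[of 4] show ?thesis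
      using n \<open>D \<ge> 0\<close> by (intro add_mono mult_left_mono mult_right_mono) auto
  qed
  also have "cmod (?E (\<lambda>l. iexp (u * a * ?X l) * (\<psi> l - e))) \<le> ?E (\<lambda>l. cmod (iexp (u * a * ?X l) * (\<psi> l - e)))"
    by (rule integral_norm_bound)
  also have "\<dots> = ?E (\<lambda>l. cmod (\<psi> l - e))"
    by (simp only: norm_mult norm_exp_i_times mult_1)
  also have "\<dots> \<le> ?E (\<lambda>l. \<bar>u\<bar> ^ 3 + u ^ 4 + u\<^sup>2 / 2 * ((?p l - 1/2)\<^sup>2 + (1/4 - v)))"
  proof (intro integral_mono_AE)
    show "AE l in hoppe_leaves \<theta> n. cmod (\<psi> l - e) \<le> \<bar>u\<bar> ^ 3 + u ^ 4 + u\<^sup>2 / 2 * ((?p l - 1/2)\<^sup>2 + (1/4 - v))"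
      unfolding AE_measure_pmf_iff \<psi>_def e_def
      by (intro ballI bernoulli_centred_char_approx leaf_prob_bounds[OF n(1)] v)
  qed simp_all
  also have "\<dots> = \<bar>u\<bar> ^ 3 + u ^ 4 + u\<^sup>2 / 2 * (?E (\<lambda>l. (?p l - 1/2)\<^sup>2) + (1/4 - v))"
    by simp
  \<comment> \<open>With \<open>v\<close> the mean conditional variance, both halves of the variance
    mismatch have the same average.\<close>
  also have "?E (\<lambda>l. (?p l - 1/2)\<^sup>2) = 1/4 - v"
    using mean_leaf_var_alt[OF n(1)] by (simp add: v_def)
  also have "\<bar>u\<bar> ^ 3 + u ^ 4 + u\<^sup>2 / 2 * ((1/4 - v) + (1/4 - v)) = \<bar>u\<bar> ^ 3 + u ^ 4 + u\<^sup>2 * (1/4 - v)"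
    by (simp add: algebra_simps)
  also have "\<dots> \<le> \<bar>u\<bar> ^ 3 + u ^ 4 + u\<^sup>2 * (D * (ln (real (Suc n)) - ln (real n)))"
  proof -
    have "ln (real n / real (Suc n)) \<le> real n / real (Suc n) - 1"
      using n by (intro ln_le_minus_one) auto
    also have "\<dots> = - 1 / real (Suc n)" by (simp add: field_simps)
    finally have "1 / real (Suc n) \<le> ln (real (Suc n)) - ln (real n)"
      using n by (simp add: ln_div)
    then have "D * (1 / real (Suc n)) \<le> D * (ln (real (Suc n)) - ln (real n))"
      using \<open>D \<ge> 0\<close> by (intro mult_left_mono)
    then show ?thesis using mean_leaf_var_lower[OF n(1)]
      by (intro add_left_mono mult_left_mono) (auto simp: v_def D_def)
  qed
  finally have "cmod (measure_pmf.expectation (hoppe_leaves \<theta> (Suc n)) (\<lambda>l. iexp (u * (real l - leaves_mean \<theta> (Suc n))))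
      - of_real (g * e)) \<le> real (Suc n) * (\<bar>u\<bar> ^ 3 + u ^ 4) + D * u\<^sup>2 * ln (real (Suc n))"
    by (simp add: algebra_simps)
  \<comment> \<open>The Gaussian factors multiply exactly as the variance recurrence
    prescribes.\<close>
  moreover have "g * e = exp (- (u\<^sup>2 * leaves_var \<theta> (Suc n) / 2))"
    by (simp add: g_def e_def leaves_var_Suc[OF n(1)] a_def v_def power_mult_distrib field_simps flip: exp_add)
  ultimately show ?case by (simp add: D_def)
qed

text \<open>Any constant below \<open>1/12\<close> would serve. The bound holds only eventually, as
  the variance vanishes at \<open>n = 2\<close>.\<close>

lemma eventually_leaves_var_ge: "\<forall>\<^sub>F n in sequentially. leaves_var \<theta> n \<ge> real n / 24"
proof -
  obtain C where C: "\<And>n. n \<ge> 3 \<Longrightarrow> \<bar>leaves_var \<theta> n - (\<theta> + real n - 1) / 12\<bar> \<le> C / (\<theta> + real n - 2)"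
    using leaves_var_dev_bound by blast
  have "\<forall>\<^sub>F n in sequentially. (\<theta> + real n - 1) / 12 - C / (\<theta> + real n - 2) \<ge> real n / 24"
    by real_asymp
  with eventually_ge_at_top[of 3] show ?thesis
  proof eventually_elim
    case (elim n)
    then show ?case using C[OF elim(1)] unfolding abs_le_iff by linarith
  qed
qed

lemma leaves_clt:
  "weak_conv_m (\<lambda>n. distr (measure_pmf (hoppe_leaves \<theta> n)) borel
      (\<lambda>k. (real k - leaves_mean \<theta> n) / sqrt (leaves_var \<theta> n))) std_normal_distribution"
proof (rule levy_continuity)
  show "real_distribution (distr (measure_pmf (hoppe_leaves \<theta> n)) borel
      (\<lambda>k. (real k - leaves_mean \<theta> n) / sqrt (leaves_var \<theta> n)))" for n
    by (intro prob_space.real_distribution_distr measure_pmf.prob_space_axioms) simp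
  show "real_distribution std_normal_distribution" by (rule real_dist_normal_dist)
next
  fix t :: real
  let ?\<mu> = "\<lambda>n. distr (measure_pmf (hoppe_leaves \<theta> n)) borel (\<lambda>k. (real k - leaves_mean \<theta> n) / sqrt (leaves_var \<theta> n))"
  define D where "D = 3 * (1 + (1 - \<theta>)\<^sup>2)"
  \<comment> \<open>From \<open>sqrt (n / 24) \<ge> sqrt n / 5\<close> the rescaled frequency
    \<open>u\<close> is at most \<open>T / sqrt n\<close> in absolute value.\<close>
  define T where "T = 5 * \<bar>t\<bar>"
  \<comment> \<open>The accumulated error at this frequency; its terms have orders
    \<open>1 / sqrt n\<close>, \<open>1 / n\<close> and \<open>ln n / n\<close>.\<close>
  define B where "B n = T ^ 3 * (real n * (1 / sqrt (real n)) ^ 3) + T ^ 4 * (real n * (1 / sqrt (real n)) ^ 4)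
     + D * T\<^sup>2 * ((1 / sqrt (real n))\<^sup>2 * ln (real n))" for n :: nat
  have "(\<lambda>n. real n * (1 / sqrt (real n)) ^ 3) \<longlonglongrightarrow> 0"
    "(\<lambda>n. real n * (1 / sqrt (real n)) ^ 4) \<longlonglongrightarrow> 0"
    "(\<lambda>n. (1 / sqrt (real n))\<^sup>2 * ln (real n)) \<longlonglongrightarrow> 0"
    by real_asymp+
  then have "B \<longlonglongrightarrow> 0"
    unfolding B_def by (intro tendsto_add_zero tendsto_mult_right_zero)
  moreover have "\<forall>\<^sub>F n in sequentially. norm (char (?\<mu> n) t - char std_normal_distribution t) \<le> B n"
    using eventually_leaves_var_ge eventually_ge_at_top[of 2]
  proof eventually_elim
    case (elim n)
    define \<sigma> where "\<sigma> = sqrt (leaves_var \<theta> n)"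
    define u where "u = t / \<sigma>"
    have V: "leaves_var \<theta> n > 0" using elim by (intro less_le_trans[OF _ elim(1)]) simp
    have "sqrt (real n) / 5 \<le> \<sigma>"
      unfolding \<sigma>_def by (rule real_le_rsqrt) (use elim in \<open>simp add: power_divide\<close>)
    moreover have "\<sigma> > 0" using V by (simp add: \<sigma>_def)
    ultimately have "\<bar>t\<bar> / \<sigma> \<le> \<bar>t\<bar> / (sqrt (real n) / 5)"
      using elim(2) by (intro divide_left_mono) auto
    then have u: "\<bar>u\<bar> \<le> T * (1 / sqrt (real n))"
      using \<open>\<sigma> > 0\<close> by (simp add: u_def T_def abs_divide mult.commute)
    have "char (?\<mu> n) t = measure_pmf.expectation (hoppe_leaves \<theta> n) (\<lambda>l. iexp (u * (real l - leaves_mean \<theta> n)))"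
      unfolding char_def u_def \<sigma>_def by (subst integral_distr) simp_all
    moreover have "char std_normal_distribution t = exp (- (u\<^sup>2 * leaves_var \<theta> n / 2))"
      using V by (simp add: char_std_normal_distribution u_def \<sigma>_def power_divide)
    ultimately have "norm (char (?\<mu> n) t - char std_normal_distribution t) \<le>
        real n * (\<bar>u\<bar> ^ 3 + u ^ 4) + D * u\<^sup>2 * ln (real n)"
      using centred_char_approx[OF elim(2), of u] by (simp add: D_def)
    also have "\<dots> = real n * (\<bar>u\<bar> ^ 3 + \<bar>u\<bar> ^ 4) + D * \<bar>u\<bar>\<^sup>2 * ln (real n)" by simp
    also have "\<dots> \<le> real n * ((T * (1 / sqrt (real n))) ^ 3 + (T * (1 / sqrt (real n))) ^ 4)
        + D * (T * (1 / sqrt (real n)))\<^sup>2 * ln (real n)"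
      using u elim(2) by (intro add_mono mult_left_mono mult_right_mono power_mono) (auto simp: D_def)
    also have "\<dots> = B n"
      unfolding B_def power_mult_distrib by (simp only: algebra_simps)
    finally show ?case .
  qed
  ultimately have "(\<lambda>n. char (?\<mu> n) t - char std_normal_distribution t) \<longlonglongrightarrow> 0"
    by (rule Lim_null_comparison[rotated])
  then show "(\<lambda>n. char (?\<mu> n) t) \<longlonglongrightarrow> char std_normal_distribution t"
    by (simp add: LIM_zero_iff)
qed

end

theorem theorem2p5:
  fixes \<theta> :: real
  assumes "\<theta> > 0"
  shows "(\<lambda>n. leaves_mean \<theta> n - (real n / 2 + (\<theta> - 1) / 2)) \<in> O(\<lambda>n. 1 / real n)
       \<and> (\<lambda>n. leaves_var \<theta> n - (real n / 12 + (\<theta> - 1) / 12)) \<in> O(\<lambda>n. 1 / real n)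
       \<and> weak_conv_m
           (\<lambda>n. distr (measure_pmf (hoppe_leaves \<theta> n)) borel
                  (\<lambda>k. (real k - leaves_mean \<theta> n) / sqrt (leaves_var \<theta> n)))
           std_normal_distribution
       \<and> (\<forall>n t. n \<ge> 1 \<longrightarrow> t > 0 \<longrightarrow>
           measure_pmf.prob (hoppe_leaves \<theta> n) {k. \<bar>real k - leaves_mean \<theta> n\<bar> \<ge> t}
             \<le> 2 * exp (- (6 * t\<^sup>2) / (real n + \<theta> + 1)))"
  using leaves_mean_asymp[OF assms] leaves_var_asymp[OF assms] leaves_clt[OF assms] leaves_tail[OF assms]
  by blast

end
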